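(* For every integer $k\ge 4$ and every integer $n\ge (k-2)(k-1)/2$, \[ T(n,k)=8n^2+2n+2(k-3). \] The threshold $(k-2)(k-1)/2$ is the least possible sum of $k-2$ distinct positive integers.
   Context: $T(n,k)$ is the minimum, over all partitions of the cube $[0,n]^3$ into $k$ axis-aligned boxes $x_j\times y_j\times z_j$ with integer corners whose dimension multisets $\{x_j,y_j,z_j\}$ are pairwise distinct, of the total surface area $\sum_{j=1}^k 2(x_jy_j+y_jz_j+z_jx_j)$. *)

theory Defs
  imports "HOL-Analysis.Analysis" "HOL-Library.Multiset"
begin

definition cube :: "nat \<Rightarrow> (real ^ 3) set" where
  "cube n = cbox 0 (\<chi> i. real n)"

definition integer_box :: "(real ^ 3) set \<Rightarrow> bool" where
  "integer_box B \<longleftrightarrow>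
    (\<exists>a b. (\<forall>i. a $ i \<in> \<int> \<and> b $ i \<in> \<int> \<and> a $ i < b $ i) \<and> B = cbox a b)"

definition side :: "(real ^ 3) set \<Rightarrow> 3 \<Rightarrow> real" where
  "side B i = interval_upperbound B $ i - interval_lowerbound B $ i"

definition dims :: "(real ^ 3) set \<Rightarrow> real multiset" where
  "dims B = {# side B 1, side B 2, side B 3 #}"

definition surface_area :: "(real ^ 3) set \<Rightarrow> real" where
  "surface_area B =
    2 * (side B 1 * side B 2 + side B 2 * side B 3 + side B 3 * side B 1)"

text \<open>
  In a \<open>division_of\<close> the boxes are closed, cover the cube, and may overlap only in their
  boundaries; degenerate boxes, which \<open>division_of\<close> would allow, are excluded by
  \<^const>\<open>integer_box\<close>.
\<close>

definition distinct_box_partition :: "nat \<Rightarrow> nat \<Rightarrow> (real ^ 3) set set \<Rightarrow> bool" where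
  "distinct_box_partition n k P \<longleftrightarrow>
    P division_of cube n \<and> card P = k \<and> (\<forall>B\<in>P. integer_box B) \<and> inj_on dims P"

definition total_areas :: "nat \<Rightarrow> nat \<Rightarrow> real set" where
  "total_areas n k = {\<Sum>B\<in>P. surface_area B | P. distinct_box_partition n k P}"

text \<open>
  The minimum is meaningful only if an admissible partition exists; in that case it is
  attained, see \<open>T_attained\<close> and \<open>T_le\<close> below.
\<close>

definition T :: "nat \<Rightarrow> nat \<Rightarrow> real" where
  "T n k = (LEAST s. s \<in> total_areas n k)"

lemma side_cbox:
  assumes "\<And>i. a $ i < b $ i"
  shows "side (cbox a b) i = b $ i - a $ i"
proof -
  have "cbox a b \<noteq> {}"
    using assms by (auto simp: interval_ne_empty_cart less_imp_le)
  then show ?thesis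
    by (simp add: side_def interval_cbox)
qed

lemma side_in_Nats:
  assumes "integer_box B"
  shows "side B i \<in> \<nat>"
proof -
  obtain a b where ab: "\<And>i. a $ i \<in> \<int> \<and> b $ i \<in> \<int> \<and> a $ i < b $ i" "B = cbox a b"
    using assms unfolding integer_box_def by blast
  then have "side B i = b $ i - a $ i"
    using side_cbox by blast
  moreover have "b $ i - a $ i \<in> \<int>" "0 \<le> b $ i - a $ i"
    using ab(1)[of i] by auto
  ultimately show ?thesis
    by (simp add: Nats_altdef2)
qed

lemma total_areas_subset_Nats: "total_areas n k \<subseteq> \<nat>"
proof -
  have "surface_area B \<in> \<nat>" if "integer_box B" for B
    using side_in_Nats[OF that] unfolding surface_area_def
    by (intro Nats_mult Nats_add) auto
  moreover have "(\<Sum>B\<in>P. surface_area B) \<in> \<nat>" if "\<And>B. B \<in> P \<Longrightarrow> surface_area B \<in> \<nat>" for P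
    using that by (induction P rule: infinite_finite_induct) auto
  ultimately show ?thesis
    unfolding total_areas_def distinct_box_partition_def by blast
qed

lemma total_areas_least:
  assumes "total_areas n k \<noteq> {}"
  shows "\<exists>s\<in>total_areas n k. T n k = s \<and> (\<forall>t\<in>total_areas n k. s \<le> t)"
proof -
  define m where "m = (LEAST m. real m \<in> total_areas n k)"
  have nat: "\<exists>j. t = real j" if "t \<in> total_areas n k" for t
    using that total_areas_subset_Nats by (blast elim: Nats_cases)
  then have "\<exists>j. real j \<in> total_areas n k"
    using assms by (metis all_not_in_conv)
  then have mem: "real m \<in> total_areas n k"
    unfolding m_def by (rule LeastI_ex)
  have le: "real m \<le> t" if "t \<in> total_areas n k" for t
    using nat[OF that] that unfolding m_def by (auto intro: Least_le)
  have "T n k = real m"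
    unfolding T_def using mem le by (intro Least_equality) auto
  with mem le show ?thesis by blast
qed

lemma T_attained: "total_areas n k \<noteq> {} \<Longrightarrow> T n k \<in> total_areas n k"
  using total_areas_least by blast

lemma T_le: "t \<in> total_areas n k \<Longrightarrow> T n k \<le> t"
  using total_areas_least by (metis empty_iff)

end

theory Submission imports Defs begin

text \<open>
  Every partition of the cube into \<open>k\<close> boxes has total surface \<open>6 n\<^sup>2 + 2 I\<close>, where \<open>I\<close> is the area
  of the faces inside the cube, so the claim is \<open>min I = n\<^sup>2 + n + (k - 3)\<close>. The lower bound
  (\<open>surface_lower_bound\<close>) holds for all partitions into at least three integer boxes.

  Upper bound: cut off an \<open>n \<times> n \<times> (n - 1)\<close> slab, then an \<open>n \<times> (n - 1) \<times> 1\<close> plate, and cut the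
  remaining \<open>n \<times> 1 \<times> 1\<close> rod into \<open>k - 2\<close> rods of distinct lengths. The lengths \<open>1, \<dots>, k - 3\<close> with
  the remainder as last length are possible exactly if \<open>n\<close> is at least the sum of the first \<open>k - 2\<close>
  positive integers (\<open>pieces_partition\<close>, \<open>pieces_surface\<close>).

  Lower bound: charge each inner face to the box whose lower face contains it, so that
  \<open>I = (\<Sum>B. f B)\<close>, where \<open>f B\<close> is the area of those among the three lower faces of \<open>B\<close> that are not
  in the boundary of the cube. All boxes but the one at the origin have \<open>f B \<ge> 1\<close>, which accounts
  for \<open>k - 1\<close>; it remains to see that \<open>f B - 1\<close> sums up to at least \<open>n\<^sup>2 + n - 2\<close>. Fix the \<open>z\<close> axis.
  Call a column of cells parallel to it cut if it is not contained in a single box, and a layer of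
  cells orthogonal to it cut if it is not contained in a single box. The lower \<open>z\<close> faces
  contribute at least the number of cut columns other than the column over the origin. Each cut
  layer contributes \<open>n - 1\<close>, by the analogous estimate for a square cut into rectangles, in which all
  columns must be cut in one of the two directions (\<open>inner_length_bound\<close>). Hence the sum is at least
  the number of cut columns off the origin plus \<open>n - 1\<close> times the number of cut layers
  (\<open>columns_layers_bound\<close>).

  If all \<open>n\<^sup>2\<close> columns of some direction are cut, one cut layer suffices, and if there is none then
  the boxes are parallel slabs (\<open>all_columns_cut_inner_area\<close>). Otherwise each direction has a box that
  spans the cube (\<open>crossing_boxes_inner_area\<close>). Then all \<open>n\<close> layers are cut, and the columns through the
  boxes spanning in \<open>x\<close> and in \<open>y\<close> direction are cut, which are at least \<open>2 n - 1\<close>; and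
  \<open>n (n - 1) + (2 n - 2) = n\<^sup>2 + n - 2\<close>.
\<close>

section \<open>Squares cut into rectangles\<close>

text \<open>
  The total length of the left and the lower side of the rectangle \<open>[x0 B, x1 B] \<times> [y0 B, y1 B]\<close>,
  where sides on the coordinate axes, hence in the boundary of the square, do not count.
\<close>

definition inner_length where
  "inner_length x0 x1 y0 y1 B =
     (if 0 < x0 B then y1 B - y0 B else 0) + (if 0 < y0 B then x1 B - x0 B else (0::nat))"
 for x0 x1 y0 y1 :: "'b \<Rightarrow> nat"

text \<open>
  The rectangles \<open>[x0 B, x1 B] \<times> [y0 B, y1 B]\<close> tile the square \<open>[0, n]\<^sup>2\<close>: each unit cell, named by
  its lower left corner \<open>(i, j)\<close>, belongs to exactly one of them.
\<close>
locale square_tiling =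
  fixes n :: nat and Q :: "'b set" and x0 x1 y0 y1 :: "'b \<Rightarrow> nat"
  assumes finite_Q: "finite Q"
    and x_bounds: "B \<in> Q \<Longrightarrow> x0 B < x1 B \<and> x1 B \<le> n"
    and y_bounds: "B \<in> Q \<Longrightarrow> y0 B < y1 B \<and> y1 B \<le> n"
    and cell: "i < n \<Longrightarrow> j < n \<Longrightarrow>
      \<exists>!B. B \<in> Q \<and> i \<in> {x0 B..<x1 B} \<and> j \<in> {y0 B..<y1 B}"
begin

lemma transposed: "square_tiling n Q y0 y1 x0 x1"
proof
  fix i j assume "i < n" "j < n"
  then show "\<exists>!B. B \<in> Q \<and> i \<in> {y0 B..<y1 B} \<and> j \<in> {x0 B..<x1 B}"
    using cell[of j i] by (simp add: conj_ac)
qed (use finite_Q x_bounds y_bounds in auto)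

lemma all_columns_cut_bound:
  assumes "\<forall>i<n. \<exists>B\<in>Q. 0 < y0 B \<and> i \<in> {x0 B..<x1 B}"
  shows "n - 1 \<le> (\<Sum>B\<in>Q. inner_length x0 x1 y0 y1 B - 1)"
proof -
  \<comment> \<open>Column 0 is left out: a rectangle that starts there has no left side inside the square, so that
    its lower side alone has to make up for the subtracted 1.\<close>
  let ?C = "\<lambda>B. if 0 < y0 B then {x0 B..<x1 B} - {0} else {}"
  have "{1..<n} \<subseteq> (\<Union>B\<in>Q. ?C B)"
    using assms by fastforce
  then have "card {1..<n} \<le> card (\<Union>B\<in>Q. ?C B)"
    using finite_Q by (intro card_mono) auto
  also have "\<dots> \<le> (\<Sum>B\<in>Q. card (?C B))"
    using finite_Q by (rule card_UN_le)
  also have "\<dots> \<le> (\<Sum>B\<in>Q. inner_length x0 x1 y0 y1 B - 1)"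
  proof (rule sum_mono)
    fix B assume "B \<in> Q"
    with x_bounds y_bounds have "x0 B < x1 B" "y0 B < y1 B" by blast+
    then show "card (?C B) \<le> inner_length x0 x1 y0 y1 B - 1"
      by (cases "x0 B = 0") (auto simp: inner_length_def)
  qed
  finally show ?thesis by simp
qed

lemma some_direction_cut:
  assumes "\<not> (\<exists>B\<in>Q. x0 B = 0 \<and> x1 B = n \<and> y0 B = 0 \<and> y1 B = n)"
  shows "(\<forall>i<n. \<exists>B\<in>Q. 0 < y0 B \<and> i \<in> {x0 B..<x1 B}) \<or>
         (\<forall>j<n. \<exists>B\<in>Q. 0 < x0 B \<and> j \<in> {y0 B..<y1 B})"
proof (rule ccontr)
  assume "\<not> ?thesis"
  then obtain i j where i: "i < n" "\<And>B. B \<in> Q \<Longrightarrow> i \<in> {x0 B..<x1 B} \<Longrightarrow> y0 B = 0"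
    and j: "j < n" "\<And>B. B \<in> Q \<Longrightarrow> j \<in> {y0 B..<y1 B} \<Longrightarrow> x0 B = 0"
    by (meson gr0I)
  \<comment> \<open>An uncut column and an uncut row meet in one cell, whose rectangle spans both.\<close>
  obtain B where B: "B \<in> Q" "i \<in> {x0 B..<x1 B}" "n - 1 \<in> {y0 B..<y1 B}"
    using cell[of i "n - 1"] i(1) by auto
  obtain C where C: "C \<in> Q" "n - 1 \<in> {x0 C..<x1 C}" "j \<in> {y0 C..<y1 C}"
    using cell[of "n - 1" j] j(1) by auto
  have "y0 B = 0" "y1 B = n" "x0 C = 0" "x1 C = n"
    using i(2)[OF B(1,2)] j(2)[OF C(1,3)] x_bounds[OF C(1)] y_bounds[OF B(1)] B(3) C(2) by auto
  moreover from this have "B = C"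
    using cell[OF i(1) j(1)] B C i(1) j(1) by auto
  ultimately show False
    using assms B(1) by blast
qed

lemma inner_length_bound:
  assumes "\<not> (\<exists>B\<in>Q. x0 B = 0 \<and> x1 B = n \<and> y0 B = 0 \<and> y1 B = n)"
  shows "n - 1 \<le> (\<Sum>B\<in>Q. inner_length x0 x1 y0 y1 B - 1)"
  using some_direction_cut[OF assms]
proof
  assume "\<forall>j<n. \<exists>B\<in>Q. 0 < x0 B \<and> j \<in> {y0 B..<y1 B}"
  from square_tiling.all_columns_cut_bound[OF transposed this] show ?thesis
    by (simp add: inner_length_def add.commute)
qed (rule all_columns_cut_bound)

end

section \<open>Cubes cut into boxes\<close>

text \<open>
  The total area of those among the three faces of a box through its lower corner that do not lie in
  the coordinate planes.
\<close>
definition inner_area where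
  "inner_area x0 x1 y0 y1 z0 z1 B =
     (if 0 < z0 B then (x1 B - x0 B) * (y1 B - y0 B) else 0) +
     (if 0 < x0 B then (y1 B - y0 B) * (z1 B - z0 B) else 0) +
     (if 0 < y0 B then (z1 B - z0 B) * (x1 B - x0 B) else (0::nat))"
 for x0 x1 y0 y1 z0 z1 :: "'b \<Rightarrow> nat"

text \<open>
  The boxes \<open>[x0 B, x1 B] \<times> [y0 B, y1 B] \<times> [z0 B, z1 B]\<close> tile the cube \<open>[0, n]\<^sup>3\<close>: each unit cell, named
  by its lower corner \<open>(i, j, l)\<close>, belongs to exactly one of them.
\<close>
locale cube_tiling =
  fixes n :: nat and P :: "'b set" and x0 x1 y0 y1 z0 z1 :: "'b \<Rightarrow> nat"
  assumes finite_P: "finite P"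
    and x_bounds: "B \<in> P \<Longrightarrow> x0 B < x1 B \<and> x1 B \<le> n"
    and y_bounds: "B \<in> P \<Longrightarrow> y0 B < y1 B \<and> y1 B \<le> n"
    and z_bounds: "B \<in> P \<Longrightarrow> z0 B < z1 B \<and> z1 B \<le> n"
    and cell: "i < n \<Longrightarrow> j < n \<Longrightarrow> l < n \<Longrightarrow>
      \<exists>!B. B \<in> P \<and> i \<in> {x0 B..<x1 B} \<and> j \<in> {y0 B..<y1 B} \<and> l \<in> {z0 B..<z1 B}"
begin

lemma rotated: "cube_tiling n P y0 y1 z0 z1 x0 x1"
proof
  fix i j l assume "i < n" "j < n" "l < n"
  then show "\<exists>!B. B \<in> P \<and> i \<in> {y0 B..<y1 B} \<and> j \<in> {z0 B..<z1 B} \<and> l \<in> {x0 B..<x1 B}"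
    using cell[of l i j] by (simp add: conj_ac)
qed (use finite_P x_bounds y_bounds z_bounds in auto)

lemma inner_area_rotated:
  "inner_area y0 y1 z0 z1 x0 x1 B = inner_area x0 x1 y0 y1 z0 z1 B"
  by (simp add: inner_area_def)

lemma cell_unique:
  assumes "B \<in> P" "C \<in> P"
    and "i \<in> {x0 B..<x1 B}" "j \<in> {y0 B..<y1 B}" "l \<in> {z0 B..<z1 B}"
    and "i \<in> {x0 C..<x1 C}" "j \<in> {y0 C..<y1 C}" "l \<in> {z0 C..<z1 C}"
  shows "B = C"
proof -
  have "i < n" "j < n" "l < n"
    using x_bounds[OF assms(1)] y_bounds[OF assms(1)] z_bounds[OF assms(1)] assms(3-5) by auto
  then show ?thesis
    using cell[of i j l] assms by blast
qed

text \<open>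
  The columns in \<open>z\<close> direction that pass through the lower \<open>z\<close> face of a box inside the cube,
  equivalently, that are not contained in a single box.
\<close>
definition cut_columns :: "(nat \<times> nat) set" where
  "cut_columns = {(i, j). i < n \<and> j < n \<and>
     (\<exists>B\<in>P. 0 < z0 B \<and> i \<in> {x0 B..<x1 B} \<and> j \<in> {y0 B..<y1 B})}"

text \<open>The layers orthogonal to the \<open>z\<close> axis that are not contained in a single box.\<close>
definition cut_layers :: "nat set" where
  "cut_layers = {l. l < n \<and>
     \<not> (\<exists>B\<in>P. l \<in> {z0 B..<z1 B} \<and> x0 B = 0 \<and> x1 B = n \<and> y0 B = 0 \<and> y1 B = n)}"

lemma layer_tiling:
  assumes "l < n"
  shows "square_tiling n {B \<in> P. l \<in> {z0 B..<z1 B}} x0 x1 y0 y1"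
proof
  fix i j assume "i < n" "j < n"
  then show "\<exists>!B. B \<in> {B \<in> P. l \<in> {z0 B..<z1 B}} \<and> i \<in> {x0 B..<x1 B} \<and> j \<in> {y0 B..<y1 B}"
    using cell[of i j l] assms by (simp add: conj_ac)
qed (use finite_P x_bounds y_bounds in auto)

lemma uncut_columnE:
  assumes "i < n" "j < n" "(i, j) \<notin> cut_columns"
  obtains B where "B \<in> P" "i \<in> {x0 B..<x1 B}" "j \<in> {y0 B..<y1 B}" "z0 B = 0" "z1 B = n"
proof -
  obtain B where B: "B \<in> P" "i \<in> {x0 B..<x1 B}" "j \<in> {y0 B..<y1 B}" "n - 1 \<in> {z0 B..<z1 B}"
    using cell[of i j "n - 1"] assms(1,2) by auto
  moreover have "z0 B = 0"
    using B assms unfolding cut_columns_def by auto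
  moreover have "z1 B = n"
    using B(4) z_bounds[OF B(1)] by auto
  ultimately show thesis
    using that by blast
qed

text \<open>
  Subtracting 1 once per box, as on the right, loses no more than subtracting it in each layer that
  the box meets, and so the estimate for tilings of a square can be applied in every layer.
\<close>
lemma sum_layers:
  "(n - 1) * card cut_layers \<le>
     (\<Sum>B\<in>P. (z1 B - z0 B) * inner_length x0 x1 y0 y1 B - 1)"
proof -
  let ?L = "\<lambda>B. inner_length x0 x1 y0 y1 B"
  have "(n - 1) * card cut_layers = (\<Sum>l\<in>cut_layers. n - 1)"
    by simp
  also have "\<dots> \<le> (\<Sum>l\<in>cut_layers. \<Sum>B | B \<in> P \<and> l \<in> {z0 B..<z1 B}. ?L B - 1)"
  proof (rule sum_mono)
    fix l assume l: "l \<in> cut_layers"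
    then have "l < n" by (simp add: cut_layers_def)
    from square_tiling.inner_length_bound[OF layer_tiling[OF this]] l
    show "n - 1 \<le> (\<Sum>B | B \<in> P \<and> l \<in> {z0 B..<z1 B}. ?L B - 1)"
      by (auto simp: cut_layers_def)
  qed
  also have "\<dots> = (\<Sum>B\<in>P. \<Sum>l | l \<in> cut_layers \<and> l \<in> {z0 B..<z1 B}. ?L B - 1)"
    using finite_P by (intro sum.swap_restrict) (auto simp: cut_layers_def)
  also have "\<dots> \<le> (\<Sum>B\<in>P. (z1 B - z0 B) * ?L B - 1)"
  proof (rule sum_mono)
    fix B assume B: "B \<in> P"
    have "card {l. l \<in> cut_layers \<and> l \<in> {z0 B..<z1 B}} \<le> card {z0 B..<z1 B}"
      by (intro card_mono) auto
    then have "(\<Sum>l | l \<in> cut_layers \<and> l \<in> {z0 B..<z1 B}. ?L B - 1) \<le> (z1 B - z0 B) * (?L B - 1)"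
      by simp
    also have "\<dots> \<le> (z1 B - z0 B) * ?L B - 1"
      using z_bounds[OF B] by (cases "?L B") auto
    finally show "(\<Sum>l | l \<in> cut_layers \<and> l \<in> {z0 B..<z1 B}. ?L B - 1) \<le>
      (z1 B - z0 B) * ?L B - 1" .
  qed
  finally show ?thesis .
qed

lemma sum_columns:
  "card (cut_columns - {(0, 0)}) \<le>
     (\<Sum>B\<in>P. if 0 < z0 B then card ({x0 B..<x1 B} \<times> {y0 B..<y1 B} - {(0, 0)}) else 0)"
proof -
  let ?C = "\<lambda>B. if 0 < z0 B then {x0 B..<x1 B} \<times> {y0 B..<y1 B} - {(0, 0)} else {}"
  have "cut_columns - {(0, 0)} \<subseteq> (\<Union>B\<in>P. ?C B)"
    unfolding cut_columns_def by fastforce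
  then have "card (cut_columns - {(0, 0)}) \<le> card (\<Union>B\<in>P. ?C B)"
    using finite_P by (intro card_mono) auto
  also have "\<dots> \<le> (\<Sum>B\<in>P. card (?C B))"
    using finite_P by (rule card_UN_le)
  also have "\<dots> = (\<Sum>B\<in>P. if 0 < z0 B then card ({x0 B..<x1 B} \<times> {y0 B..<y1 B} - {(0, 0)}) else 0)"
    by (intro sum.cong) auto
  finally show ?thesis .
qed

lemma inner_area_pos_iff:
  assumes "B \<in> P"
  shows "0 < inner_area x0 x1 y0 y1 z0 z1 B \<longleftrightarrow> 0 < x0 B \<or> 0 < y0 B \<or> 0 < z0 B"
  using x_bounds[OF assms] y_bounds[OF assms] z_bounds[OF assms] by (simp add: inner_area_def)

lemma card_le_positive_inner_area:
  "card P \<le> card {B \<in> P. 0 < inner_area x0 x1 y0 y1 z0 z1 B} + 1"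
proof -
  let ?Z = "{B \<in> P. inner_area x0 x1 y0 y1 z0 z1 B = 0}"
  have origin: "0 \<in> {x0 B..<x1 B}" "0 \<in> {y0 B..<y1 B}" "0 \<in> {z0 B..<z1 B}" if "B \<in> ?Z" for B
    using that inner_area_pos_iff[of B] x_bounds[of B] y_bounds[of B] z_bounds[of B] by simp_all
  have "B = C" if "B \<in> ?Z" "C \<in> ?Z" for B C
    using cell_unique[OF _ _ origin[OF that(1)] origin[OF that(2)]] that by blast
  then have "card ?Z \<le> 1"
    using finite_P unfolding One_nat_def by (subst card_le_Suc0_iff_eq) auto
  moreover have "P = {B \<in> P. 0 < inner_area x0 x1 y0 y1 z0 z1 B} \<union> ?Z" by auto
  then have "card P \<le> card {B \<in> P. 0 < inner_area x0 x1 y0 y1 z0 z1 B} + card ?Z"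
    using card_Un_le by metis
  ultimately show ?thesis by simp
qed

text \<open>
  The summands are what the box contributes to the cut columns, its surplus that goes to the cut
  layers, and 1 for the number of boxes. Truncated subtraction matters twice: a box over the origin
  of the \<open>xy\<close> plane has no lower side faces inside the cube, and pays its 1 with the cell that is removed from its
  lower face; the box at the origin contributes 0 throughout.
\<close>
lemma inner_area_decomposition:
  assumes "B \<in> P"
  shows "inner_area x0 x1 y0 y1 z0 z1 B =
    (if 0 < z0 B then card ({x0 B..<x1 B} \<times> {y0 B..<y1 B} - {(0, 0)}) else 0) +
    ((z1 B - z0 B) * inner_length x0 x1 y0 y1 B - 1) +
    (if 0 < inner_area x0 x1 y0 y1 z0 z1 B then 1 else 0)"
proof (cases "x0 B = 0 \<and> y0 B = 0")
  case True
  then have "(0, 0) \<in> {x0 B..<x1 B} \<times> {y0 B..<y1 B}"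
    using x_bounds[OF assms] y_bounds[OF assms] by auto
  with True x_bounds[OF assms] y_bounds[OF assms] show ?thesis
    by (auto simp: inner_area_def inner_length_def card_Diff_singleton)
next
  case False
  then have *: "{x0 B..<x1 B} \<times> {y0 B..<y1 B} - {(0, 0)} = {x0 B..<x1 B} \<times> {y0 B..<y1 B}"
    by auto
  have "0 < (z1 B - z0 B) * inner_length x0 x1 y0 y1 B"
    using False x_bounds[OF assms] y_bounds[OF assms] z_bounds[OF assms]
    by (auto simp: inner_length_def)
  moreover have "inner_area x0 x1 y0 y1 z0 z1 B =
     (if 0 < z0 B then (x1 B - x0 B) * (y1 B - y0 B) else 0) +
     (z1 B - z0 B) * inner_length x0 x1 y0 y1 B"
    by (simp add: inner_area_def inner_length_def algebra_simps)
  ultimately show ?thesis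
    unfolding * by (simp add: card_cartesian_product)
qed

lemma columns_layers_bound:
  "card (cut_columns - {(0, 0)}) + (n - 1) * card cut_layers + card P
     \<le> (\<Sum>B\<in>P. inner_area x0 x1 y0 y1 z0 z1 B) + 1"
proof -
  have "(\<Sum>B\<in>P. inner_area x0 x1 y0 y1 z0 z1 B) =
    (\<Sum>B\<in>P. if 0 < z0 B then card ({x0 B..<x1 B} \<times> {y0 B..<y1 B} - {(0, 0)}) else 0) +
    (\<Sum>B\<in>P. (z1 B - z0 B) * inner_length x0 x1 y0 y1 B - 1) +
    (\<Sum>B\<in>P. if 0 < inner_area x0 x1 y0 y1 z0 z1 B then 1 else 0)"
    unfolding sum.distrib[symmetric] using inner_area_decomposition by (intro sum.cong) auto
  moreover have "(\<Sum>B\<in>P. if 0 < inner_area x0 x1 y0 y1 z0 z1 B then 1 else 0) =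
    card {B \<in> P. 0 < inner_area x0 x1 y0 y1 z0 z1 B}"
    using finite_P by (simp add: sum.If_cases Int_def)
  ultimately show ?thesis
    using sum_layers sum_columns card_le_positive_inner_area by linarith
qed

lemma n_pos: "P \<noteq> {} \<Longrightarrow> 0 < n"
  using x_bounds by fastforce

lemma full_box_card:
  assumes "B \<in> P" "x0 B = 0" "x1 B = n" "y0 B = 0" "y1 B = n" "z0 B = 0" "z1 B = n"
  shows "card P = 1"
proof -
  have "C = B" if "C \<in> P" for C
    by (rule cell_unique[of C B "x0 C" "y0 C" "z0 C"])
       (use assms that x_bounds[OF that] y_bounds[OF that] z_bounds[OF that] in auto)
  then have "P = {B}" using assms(1) by blast
  then show ?thesis by simp
qed

lemma all_columns_cut_inner_area:
  assumes cut: "\<forall>i<n. \<forall>j<n. (i, j) \<in> cut_columns" and card: "3 \<le> card P"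
  shows "n\<^sup>2 + n + card P \<le> (\<Sum>B\<in>P. inner_area x0 x1 y0 y1 z0 z1 B) + 3"
proof (cases "cut_layers = {}")
  case False
  \<comment> \<open>The columns give \<open>n\<^sup>2 - 1\<close>, and a single cut layer the missing \<open>n - 1\<close>.\<close>
  have n: "0 < n" using card n_pos by fastforce
  have "cut_columns = {..<n} \<times> {..<n}"
    using cut by (auto simp: cut_columns_def)
  then have "card (cut_columns - {(0, 0)}) = n\<^sup>2 - 1"
    using n by (simp add: card_Diff_singleton power2_eq_square)
  moreover have "finite cut_layers" by (simp add: cut_layers_def)
  then have "n - 1 \<le> (n - 1) * card cut_layers"
    using False by (simp add: Suc_leI card_gt_0_iff)
  moreover have "1 \<le> n\<^sup>2" using n by simp
  ultimately show ?thesis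
    using columns_layers_bound n by linarith
next
  case True
  \<comment> \<open>All boxes are slabs, and all but one of them have an inner lower face of area \<open>n\<^sup>2\<close>.\<close>
  have n: "0 < n" using card n_pos by fastforce
  have slab: "x0 B = 0 \<and> x1 B = n \<and> y0 B = 0 \<and> y1 B = n" if B: "B \<in> P" for B
  proof -
    have "z0 B < n" using z_bounds[OF B] by simp
    then obtain C where C: "C \<in> P" "z0 B \<in> {z0 C..<z1 C}" "x0 C = 0" "x1 C = n" "y0 C = 0" "y1 C = n"
      using True unfolding cut_layers_def by blast
    have "B = C"
      by (rule cell_unique[of B C "x0 B" "y0 B" "z0 B"])
         (use B C x_bounds[OF B] y_bounds[OF B] z_bounds[OF B] in auto)
    with C show ?thesis by simp
  qed
  have "card P - 1 \<le> card {B \<in> P. 0 < inner_area x0 x1 y0 y1 z0 z1 B}"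
    using card_le_positive_inner_area by simp
  then have "(card P - 1) * n\<^sup>2 \<le> (\<Sum>B | B \<in> P \<and> 0 < inner_area x0 x1 y0 y1 z0 z1 B. n\<^sup>2)"
    by simp
  also have "\<dots> \<le> (\<Sum>B | B \<in> P \<and> 0 < inner_area x0 x1 y0 y1 z0 z1 B. inner_area x0 x1 y0 y1 z0 z1 B)"
    using slab by (intro sum_mono) (auto simp: inner_area_def power2_eq_square split: if_splits)
  also have "\<dots> \<le> (\<Sum>B\<in>P. inner_area x0 x1 y0 y1 z0 z1 B)"
    using finite_P by (intro sum_mono2) auto
  finally have "(card P - 1) * n\<^sup>2 \<le> (\<Sum>B\<in>P. inner_area x0 x1 y0 y1 z0 z1 B)" .
  moreover obtain c where c: "card P = c + 3" using card by (metis le_add_diff_inverse2)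
  moreover have "(card P - 1) * n\<^sup>2 = c * n\<^sup>2 + 2 * n\<^sup>2"
    by (simp add: c algebra_simps)
  moreover have "c \<le> c * n\<^sup>2" "n \<le> n\<^sup>2" using n by (auto simp: power2_eq_square)
  ultimately show ?thesis
    by linarith
qed

lemma crossing_boxes_inner_area:
  assumes X: "X \<in> P" "x0 X = 0" "x1 X = n" and Y: "Y \<in> P" "y0 Y = 0" "y1 Y = n"
    and Z: "Z \<in> P" "z0 Z = 0" "z1 Z = n"
    and card: "3 \<le> card P"
  shows "n\<^sup>2 + n + card P \<le> (\<Sum>B\<in>P. inner_area x0 x1 y0 y1 z0 z1 B) + 3"
proof -
  have n: "0 < n" using card n_pos by fastforce
  note bX = x_bounds[OF X(1)] y_bounds[OF X(1)] z_bounds[OF X(1)]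
  note bY = x_bounds[OF Y(1)] y_bounds[OF Y(1)] z_bounds[OF Y(1)]
  note bZ = x_bounds[OF Z(1)] y_bounds[OF Z(1)] z_bounds[OF Z(1)]
  have not_full: False
    if "B \<in> P" "x0 B = 0" "x1 B = n" "y0 B = 0" "y1 B = n" "z0 B = 0" "z1 B = n" for B
    using full_box_card[OF that] card by simp
  \<comment> \<open>A box that spans the cube in two directions meets the box that spans it in the third one.\<close>
  have no_xy: False if B: "B \<in> P" "x0 B = 0" "x1 B = n" "y0 B = 0" "y1 B = n" for B
  proof -
    have "B = Z"
      by (rule cell_unique[of B Z "x0 Z" "y0 Z" "z0 B"])
         (use B Z bZ z_bounds[OF B(1)] in auto)
    then show False using not_full B Z by blast
  qed
  have no_xz: False if B: "B \<in> P" "x0 B = 0" "x1 B = n" "z0 B = 0" "z1 B = n" for B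
  proof -
    have "B = Y"
      by (rule cell_unique[of B Y "x0 Y" "y0 B" "z0 Y"])
         (use B Y bY y_bounds[OF B(1)] in auto)
    then show False using not_full B Y by blast
  qed
  have no_yz: False if B: "B \<in> P" "y0 B = 0" "y1 B = n" "z0 B = 0" "z1 B = n" for B
  proof -
    have "B = X"
      by (rule cell_unique[of B X "x0 B" "y0 X" "z0 X"])
         (use B X bX x_bounds[OF B(1)] in auto)
    then show False using not_full B X by blast
  qed
  have "cut_layers = {..<n}"
    using no_xy by (auto simp: cut_layers_def)
  then have layers: "(n - 1) * card cut_layers = (n - 1) * n" by simp
  have rowX: "(i, y0 X) \<in> cut_columns" if i: "i < n" for i
  proof (rule ccontr)
    assume "(i, y0 X) \<notin> cut_columns"
    then obtain B where B: "B \<in> P" "i \<in> {x0 B..<x1 B}" "y0 X \<in> {y0 B..<y1 B}" "z0 B = 0" "z1 B = n"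
      using uncut_columnE[of i "y0 X"] i bX by auto
    have "B = X"
      by (rule cell_unique[of B X i "y0 X" "z0 X"]) (use B X bX that in auto)
    then show False using no_xz B X by blast
  qed
  have rowY: "(x0 Y, j) \<in> cut_columns" if j: "j < n" for j
  proof (rule ccontr)
    assume "(x0 Y, j) \<notin> cut_columns"
    then obtain B where B: "B \<in> P" "x0 Y \<in> {x0 B..<x1 B}" "j \<in> {y0 B..<y1 B}" "z0 B = 0" "z1 B = n"
      using uncut_columnE[of "x0 Y" j] j bY by auto
    have "B = Y"
      by (rule cell_unique[of B Y "x0 Y" j "z0 Y"]) (use B Y bY that in auto)
    then show False using no_yz B Y by blast
  qed
  \<comment> \<open>In the projection to the \<open>xy\<close> plane, a full row and a full column of cells are cut, which
    share the cell \<open>(x0 Y, y0 X)\<close>.\<close>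
  let ?R = "{..<n} \<times> {y0 X}" and ?S = "{x0 Y} \<times> ({..<n} - {y0 X})"
  have "card (?R \<union> ?S) = n + (n - 1)"
    using bX by (subst card_Un_disjoint) (auto simp: card_cartesian_product)
  moreover have "?R \<union> ?S \<subseteq> cut_columns"
    using rowX rowY by auto
  moreover have "finite cut_columns"
    by (rule finite_subset[of _ "{..<n} \<times> {..<n}"]) (auto simp: cut_columns_def)
  ultimately have "n + (n - 1) \<le> card cut_columns"
    by (metis card_mono)
  then have "n + (n - 1) - 1 \<le> card (cut_columns - {(0, 0)})"
    using diff_card_le_card_Diff[of "{(0, 0)}" cut_columns] by simp
  moreover have "(n - 1) * n + n = n\<^sup>2"
    using n by (cases n) (auto simp: power2_eq_square)
  ultimately show ?thesis
    using columns_layers_bound layers n by linarith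
qed

text \<open>
  Either all columns are cut in one of the three directions, or each direction has an uncut column
  and hence a box that spans the cube in this direction.
\<close>
theorem inner_area_bound:
  assumes card: "3 \<le> card P"
  shows "n\<^sup>2 + n + card P \<le> (\<Sum>B\<in>P. inner_area x0 x1 y0 y1 z0 z1 B) + 3"
proof -
  interpret yzx: cube_tiling n P y0 y1 z0 z1 x0 x1 by (rule rotated)
  interpret zxy: cube_tiling n P z0 z1 x0 x1 y0 y1 by (rule yzx.rotated)
  have rot: "inner_area z0 z1 x0 x1 y0 y1 B = inner_area x0 x1 y0 y1 z0 z1 B" for B
    by (simp add: inner_area_def)
  show ?thesis
  proof (cases "(\<forall>i<n. \<forall>j<n. (i, j) \<in> cut_columns) \<or>
      (\<forall>i<n. \<forall>j<n. (i, j) \<in> yzx.cut_columns) \<or> (\<forall>i<n. \<forall>j<n. (i, j) \<in> zxy.cut_columns)")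
    case True
    then show ?thesis
    proof (elim disjE)
      assume "\<forall>i<n. \<forall>j<n. (i, j) \<in> cut_columns"
      then show ?thesis using card by (rule all_columns_cut_inner_area)
    next
      assume "\<forall>i<n. \<forall>j<n. (i, j) \<in> yzx.cut_columns"
      from yzx.all_columns_cut_inner_area[OF this card] show ?thesis
        by (simp add: inner_area_rotated)
    next
      assume "\<forall>i<n. \<forall>j<n. (i, j) \<in> zxy.cut_columns"
      from zxy.all_columns_cut_inner_area[OF this card] show ?thesis
        by (simp add: rot)
    qed
  next
    case False
    obtain i j where "i < n" "j < n" "(i, j) \<notin> cut_columns" using False by blast
    then obtain Z where Z: "Z \<in> P" "z0 Z = 0" "z1 Z = n" by (rule uncut_columnE)
    obtain i j where "i < n" "j < n" "(i, j) \<notin> yzx.cut_columns" using False by blast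
    then obtain X where X: "X \<in> P" "x0 X = 0" "x1 X = n" by (rule yzx.uncut_columnE)
    obtain i j where "i < n" "j < n" "(i, j) \<notin> zxy.cut_columns" using False by blast
    then obtain Y where Y: "Y \<in> P" "y0 Y = 0" "y1 Y = n" by (rule zxy.uncut_columnE)
    show ?thesis using X Y Z card by (rule crossing_boxes_inner_area)
  qed
qed

text \<open>The lower \<open>z\<close> faces in the plane \<open>z = 0\<close> cover a face of the cube.\<close>
lemma sum_z_faces:
  "n\<^sup>2 + (\<Sum>B\<in>P. if 0 < z0 B then (x1 B - x0 B) * (y1 B - y0 B) else 0)
     \<le> (\<Sum>B\<in>P. (x1 B - x0 B) * (y1 B - y0 B))"
proof -
  let ?C = "\<lambda>B. if z0 B = 0 then {x0 B..<x1 B} \<times> {y0 B..<y1 B} else {}"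
  have "{..<n} \<times> {..<n} \<subseteq> (\<Union>B\<in>P. ?C B)"
  proof (rule subrelI)
    fix i j assume "(i, j) \<in> {..<n} \<times> {..<n}"
    then obtain B where "B \<in> P" "i \<in> {x0 B..<x1 B}" "j \<in> {y0 B..<y1 B}" "0 \<in> {z0 B..<z1 B}"
      using cell[of i j 0] by auto
    then show "(i, j) \<in> (\<Union>B\<in>P. ?C B)" by force
  qed
  then have "card ({..<n} \<times> {..<n}) \<le> card (\<Union>B\<in>P. ?C B)"
    using finite_P by (intro card_mono) auto
  also have "\<dots> \<le> (\<Sum>B\<in>P. card (?C B))"
    using finite_P by (rule card_UN_le)
  finally have "n\<^sup>2 \<le> (\<Sum>B\<in>P. card (?C B))"
    by (simp add: power2_eq_square)
  then have "n\<^sup>2 + (\<Sum>B\<in>P. if 0 < z0 B then (x1 B - x0 B) * (y1 B - y0 B) else 0) \<le>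
     (\<Sum>B\<in>P. card (?C B) + (if 0 < z0 B then (x1 B - x0 B) * (y1 B - y0 B) else 0))"
    by (simp add: sum.distrib)
  also have "\<dots> = (\<Sum>B\<in>P. (x1 B - x0 B) * (y1 B - y0 B))"
    by (intro sum.cong) (auto simp: card_cartesian_product)
  finally show ?thesis .
qed

theorem half_surface_bound:
  assumes card: "3 \<le> card P"
  shows "4 * n\<^sup>2 + n + card P \<le>
    (\<Sum>B\<in>P. (x1 B - x0 B) * (y1 B - y0 B) + (y1 B - y0 B) * (z1 B - z0 B)
          + (z1 B - z0 B) * (x1 B - x0 B)) + 3"
proof -
  interpret yzx: cube_tiling n P y0 y1 z0 z1 x0 x1 by (rule rotated)
  interpret zxy: cube_tiling n P z0 z1 x0 x1 y0 y1 by (rule yzx.rotated)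
  show ?thesis
    using inner_area_bound[OF card] sum_z_faces yzx.sum_z_faces zxy.sum_z_faces
    unfolding inner_area_def sum.distrib by linarith
qed

end

section \<open>Divisions into integer boxes as tilings\<close>

lemma mem_cbox_3: "(x :: real^3) \<in> cbox a b \<longleftrightarrow>
    a $ 1 \<le> x $ 1 \<and> x $ 1 \<le> b $ 1 \<and> a $ 2 \<le> x $ 2 \<and> x $ 2 \<le> b $ 2 \<and> a $ 3 \<le> x $ 3 \<and> x $ 3 \<le> b $ 3"
  by (auto simp: mem_box_cart forall_3)

lemma mem_box_3: "(x :: real^3) \<in> box a b \<longleftrightarrow>
    a $ 1 < x $ 1 \<and> x $ 1 < b $ 1 \<and> a $ 2 < x $ 2 \<and> x $ 2 < b $ 2 \<and> a $ 3 < x $ 3 \<and> x $ 3 < b $ 3"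
  by (auto simp: mem_box_cart forall_3)

text \<open>
  The coordinates of the lower and the upper corner, as natural numbers; rounding has no effect on
  integer boxes inside the cube.
\<close>
definition lower :: "3 \<Rightarrow> (real ^ 3) set \<Rightarrow> nat" where
  "lower i B = nat \<lfloor>interval_lowerbound B $ i\<rfloor>"

definition upper :: "3 \<Rightarrow> (real ^ 3) set \<Rightarrow> nat" where
  "upper i B = nat \<lfloor>interval_upperbound B $ i\<rfloor>"

lemma integer_box_in_cube:
  assumes "integer_box B" "B \<subseteq> cube n"
  shows "B = cbox (\<chi> i. real (lower i B)) (\<chi> i. real (upper i B))"
    and "lower i B < upper i B" and "upper i B \<le> n"
    and "side B i = real (upper i B - lower i B)"
proof -
  obtain a b where ab: "\<And>i. a $ i \<in> \<int>" "\<And>i. b $ i \<in> \<int>" "\<And>i. a $ i < b $ i" "B = cbox a b"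
    using assms(1) unfolding integer_box_def by blast
  have ne: "cbox a b \<noteq> {}"
    using ab(3) by (auto simp: interval_ne_empty_cart less_imp_le)
  have "a \<in> cube n" "b \<in> cube n"
    using assms(2) ab(3,4) by (auto simp: subset_iff mem_box_cart less_imp_le)
  then have bounds: "0 \<le> a $ i" "b $ i \<le> real n" for i
    by (auto simp: cube_def mem_box_cart)
  have lo: "real (lower i B) = a $ i" for i
    using ab(1)[of i] bounds(1)[of i] ne by (auto simp: lower_def ab(4) interval_cbox elim: Ints_cases)
  have "0 \<le> b $ i" for i
    using ab(3)[of i] bounds(1)[of i] by linarith
  then have hi: "real (upper i B) = b $ i" for i
    using ab(2)[of i] ne by (auto simp: upper_def ab(4) interval_cbox elim: Ints_cases)
  show "B = cbox (\<chi> i. real (lower i B)) (\<chi> i. real (upper i B))"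
    unfolding lo hi by (simp add: ab(4))
  show lt: "lower i B < upper i B"
    using ab(3)[of i] unfolding lo[symmetric] hi[symmetric] by simp
  show "upper i B \<le> n"
    using bounds(2)[of i] unfolding hi[symmetric] by simp
  show "side B i = real (upper i B - lower i B)"
    using lt side_cbox[OF ab(3)] by (simp add: lo[symmetric] hi[symmetric] ab(4)[symmetric] of_nat_diff)
qed

lemma centre_in_integer_box:
  fixes f :: "3 \<Rightarrow> nat"
  assumes "integer_box B" "B \<subseteq> cube n"
  shows "(\<chi> i. real (f i) + 1 / 2) \<in> B \<longleftrightarrow> (\<forall>i. f i \<in> {lower i B..<upper i B})"
    and "(\<chi> i. real (f i) + 1 / 2) \<in> interior B \<longleftrightarrow> (\<forall>i. f i \<in> {lower i B..<upper i B})"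
proof -
  have *: "(real l \<le> real m + 1 / 2 \<longleftrightarrow> l \<le> m) \<and> (real m + 1 / 2 \<le> real l \<longleftrightarrow> m < l) \<and>
     (real l < real m + 1 / 2 \<longleftrightarrow> l \<le> m) \<and> (real m + 1 / 2 < real l \<longleftrightarrow> m < l)" for l m :: nat
    by linarith
  note B = integer_box_in_cube(1)[OF assms]
  show "(\<chi> i. real (f i) + 1 / 2) \<in> B \<longleftrightarrow> (\<forall>i. f i \<in> {lower i B..<upper i B})"
    by (subst B) (simp add: mem_box_cart *)
  show "(\<chi> i. real (f i) + 1 / 2) \<in> interior B \<longleftrightarrow> (\<forall>i. f i \<in> {lower i B..<upper i B})"
    by (subst B) (simp add: mem_box_cart * interior_cbox)
qed

text \<open>
  The centre of a unit cell is never on the boundary of an integer box, so it is in exactly one box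
  of the division, although the closed boxes overlap in their boundaries.
\<close>
lemma division_cells:
  assumes "P division_of cube n" "\<forall>B\<in>P. integer_box B" and f: "\<And>i. f i < n"
  shows "\<exists>!B. B \<in> P \<and> (\<forall>i. f i \<in> {lower i B..<upper i B})"
proof -
  let ?c = "(\<chi> i. real (f i) + 1 / 2) :: real ^ 3"
  have sub: "B \<subseteq> cube n" if "B \<in> P" for B
    using assms(1) that by blast
  have "real (f i) + 1 / 2 \<le> real n" for i
    using f[of i] by linarith
  then have "?c \<in> cube n"
    by (simp add: cube_def mem_box_cart)
  then obtain B where B: "B \<in> P" "?c \<in> B"
    using division_ofD(6)[OF assms(1)] by blast
  show ?thesis
  proof (rule ex1I[of _ B])
    show "B \<in> P \<and> (\<forall>i. f i \<in> {lower i B..<upper i B})"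
      using B centre_in_integer_box(1) assms(2) sub by blast
    then have "?c \<in> interior B"
      using centre_in_integer_box(2) assms(2) sub by blast
    moreover fix C assume C: "C \<in> P \<and> (\<forall>i. f i \<in> {lower i C..<upper i C})"
    then have "?c \<in> interior C"
      using centre_in_integer_box(2) assms(2) sub by blast
    ultimately show "C = B"
      using division_ofD(5)[OF assms(1)] B(1) C by blast
  qed
qed

lemma division_cube_tiling:
  assumes "P division_of cube n" "\<forall>B\<in>P. integer_box B"
  shows "cube_tiling n P (lower 1) (upper 1) (lower 2) (upper 2) (lower 3) (upper 3)"
proof
  fix i j l assume "i < n" "j < n" "l < n"
  then have "\<exists>!B. B \<in> P \<and> (\<forall>c. (if c = 1 then i else if c = 2 then j else l) \<in> {lower c B..<upper c B})"
    by (intro division_cells[OF assms]) simp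
  then show "\<exists>!B. B \<in> P \<and> i \<in> {lower 1 B..<upper 1 B} \<and> j \<in> {lower 2 B..<upper 2 B} \<and>
      l \<in> {lower 3 B..<upper 3 B}"
    by (simp add: forall_3)
next
  show "finite P" using assms(1) by blast
  fix B assume B: "B \<in> P"
  then have "integer_box B" "B \<subseteq> cube n" using assms by blast+
  note b = integer_box_in_cube(2,3)[OF this]
  show "lower 1 B < upper 1 B \<and> upper 1 B \<le> n" "lower 2 B < upper 2 B \<and> upper 2 B \<le> n"
    "lower 3 B < upper 3 B \<and> upper 3 B \<le> n"
    using b by blast+
qed

theorem surface_lower_bound:
  assumes "P division_of cube n" "\<forall>B\<in>P. integer_box B" and card: "3 \<le> card P"
  shows "8 * (real n)^2 + 2 * real n + 2 * (real (card P) - 3) \<le> (\<Sum>B\<in>P. surface_area B)"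
proof -
  interpret cube_tiling n P "lower 1" "upper 1" "lower 2" "upper 2" "lower 3" "upper 3"
    by (rule division_cube_tiling) fact+
  let ?d = "\<lambda>i B. upper i B - lower i B"
  have "(\<Sum>B\<in>P. surface_area B) =
      (\<Sum>B\<in>P. 2 * real (?d 1 B * ?d 2 B + ?d 2 B * ?d 3 B + ?d 3 B * ?d 1 B))"
  proof (rule sum.cong)
    fix B assume "B \<in> P"
    then have "integer_box B" "B \<subseteq> cube n" using assms by blast+
    note side = integer_box_in_cube(4)[OF this]
    show "surface_area B = 2 * real (?d 1 B * ?d 2 B + ?d 2 B * ?d 3 B + ?d 3 B * ?d 1 B)"
      unfolding surface_area_def side of_nat_add of_nat_mult by simp
  qed simp
  also have "\<dots> = 2 * real (\<Sum>B\<in>P. ?d 1 B * ?d 2 B + ?d 2 B * ?d 3 B + ?d 3 B * ?d 1 B)"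
    unfolding of_nat_sum sum_distrib_left ..
  finally have eq: "(\<Sum>B\<in>P. surface_area B) =
    2 * real (\<Sum>B\<in>P. ?d 1 B * ?d 2 B + ?d 2 B * ?d 3 B + ?d 3 B * ?d 1 B)" .
  have "real (4 * n\<^sup>2 + n + card P) \<le>
      real ((\<Sum>B\<in>P. ?d 1 B * ?d 2 B + ?d 2 B * ?d 3 B + ?d 3 B * ?d 1 B) + 3)"
    using half_surface_bound[OF card] by (rule of_nat_mono)
  then show ?thesis
    unfolding eq by simp
qed

section \<open>Sums of distinct positive integers\<close>

lemma sum_distinct_pos_ge:
  fixes A :: "nat set"
  assumes "finite A" "\<forall>a\<in>A. 0 < a"
  shows "card A * (card A + 1) \<le> 2 * \<Sum>A"
  using assms
proof (induction A rule: finite_linorder_max_induct)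
  case (insert b A)
  \<comment> \<open>The largest element is at least the number of elements.\<close>
  have "A \<subseteq> {1..<b}" using insert by auto
  then have "card A \<le> b - 1" using card_mono[of "{1..<b}" A] by simp
  then have "card A + 1 \<le> b" using insert.prems by auto
  moreover have "b \<notin> A" using insert.hyps by auto
  ultimately show ?case using insert by (simp add: algebra_simps)
qed simp

lemma least_sum_distinct_pos:
  "(LEAST s::nat. \<exists>A::nat set. finite A \<and> card A = m \<and> (\<forall>a\<in>A. a > 0) \<and> s = \<Sum>A) = m * (m + 1) div 2"
proof (rule Least_equality)
  have "\<Sum>{1..m} = m * (m + 1) div 2"
    using gauss_sum_from_Suc_0[of m, where ?'a = nat] by simp
  then show "\<exists>A::nat set. finite A \<and> card A = m \<and> (\<forall>a\<in>A. a > 0) \<and> m * (m + 1) div 2 = \<Sum>A"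
    by (intro exI[of _ "{1..m}"]) auto
next
  fix s assume "\<exists>A::nat set. finite A \<and> card A = m \<and> (\<forall>a\<in>A. a > 0) \<and> s = \<Sum>A"
  then show "m * (m + 1) div 2 \<le> s"
    using sum_distinct_pos_ge by fastforce
qed

section \<open>The optimal partition\<close>

text \<open>
  The partition has \<open>K + 2\<close> boxes, of which \<open>K\<close> are rods of thickness 1.
\<close>
locale rod_construction =
  fixes n K :: nat
  assumes K: "2 \<le> K" and n: "K * (K + 1) div 2 \<le> n"
begin

text \<open>
  The heights at which the \<open>1 \<times> 1 \<times> n\<close> rod is cut: the \<open>m\<close>-th rod, counted from 0, has length
  \<open>m + 1\<close> except that the last one, \<open>m = K - 1\<close>, takes all that remains, which is at least \<open>K\<close>.
\<close>
definition cut :: "nat \<Rightarrow> nat" where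
  "cut m = (if m < K then m * (m + 1) div 2 else n)"

text \<open>The rods, for \<open>m < K\<close>, then the plate, \<open>m = K\<close>, and the slab, \<open>m = K + 1\<close>.\<close>
definition piece :: "nat \<Rightarrow> (real ^ 3) set" where
  "piece m =
    (if m < K then cbox (vector [0, 0, real (cut m)]) (vector [1, 1, real (cut (Suc m))])
     else if m = K then cbox (vector [0, 1, 0]) (vector [1, real n, real n])
     else cbox (vector [1, 0, 0]) (vector [real n, real n, real n]))"

lemma n_ge_3: "3 \<le> n"
proof -
  have "2 * 3 \<le> K * (K + 1)" using K by (intro mult_mono) auto
  then show ?thesis using n by linarith
qed

lemma cut_0: "cut 0 = 0" and cut_K: "cut K = n"
  using K by (auto simp: cut_def)

lemma cut_Suc: "m < K \<Longrightarrow> cut m + Suc m \<le> cut (Suc m)"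
  and cut_Suc_eq: "Suc m < K \<Longrightarrow> cut (Suc m) = cut m + Suc m"
proof -
  have *: "Suc m * (Suc m + 1) div 2 = m * (m + 1) div 2 + Suc m"
    by (simp add: algebra_simps)
  then show "Suc m < K \<Longrightarrow> cut (Suc m) = cut m + Suc m"
    by (simp add: cut_def)
  show "cut m + Suc m \<le> cut (Suc m)" if "m < K"
  proof (cases "Suc m < K")
    case True then show ?thesis using * by (simp add: cut_def)
  next
    case False
    then have "K = Suc m" using that by simp
    then show ?thesis using n * unfolding cut_def by simp
  qed
qed

lemma cut_mono: "l \<le> m \<Longrightarrow> m \<le> K \<Longrightarrow> cut l \<le> cut m"
proof (induction m rule: dec_induct)
  case (step m)
  then show ?case using cut_Suc[of m] by simp
qed simp

lemma cut_le: "m \<le> K \<Longrightarrow> cut m \<le> n"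
  using cut_mono[of m K] cut_K by simp

lemma rod_cells:
  assumes "0 \<le> t" "t \<le> real (cut m)" "0 < m"
  shows "\<exists>l<m. real (cut l) \<le> t \<and> t \<le> real (cut (Suc l))"
  using assms(3,2)
proof (induction m rule: nat_induct_non_zero)
  case 1
  then show ?case using assms(1) cut_0 by auto
next
  case (Suc m)
  then show ?case by (cases "t \<le> real (cut m)") (auto intro: less_SucI)
qed

lemma rods_division:
  "piece ` {..<K} division_of cbox 0 (vector [1, 1, real n])"
proof (rule division_ofI)
  fix B assume "B \<in> piece ` {..<K}"
  then obtain m where m: "m < K" "B = piece m" by auto
  have le: "cut m \<le> cut (Suc m)" "cut (Suc m) \<le> n"
    using cut_Suc[OF m(1)] cut_le[of "Suc m"] m(1) by auto
  then have le': "real (cut (Suc m)) \<le> real n" by simp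
  show "B \<subseteq> cbox 0 (vector [1, 1, real n])"
    using m le' by (auto simp: piece_def mem_cbox_3)
  have "vector [0, 0, real (cut m)] \<in> B"
    using m le by (auto simp: piece_def mem_cbox_3)
  then show "B \<noteq> {}" by auto
  show "\<exists>a b. B = cbox a b"
    using m by (auto simp: piece_def)
next
  fix B C assume "B \<in> piece ` {..<K}" "C \<in> piece ` {..<K}" "B \<noteq> C"
  then obtain l m where lm: "l < K" "B = piece l" "m < K" "C = piece m" "l \<noteq> m" by auto
  have "cut (Suc l) \<le> cut m \<or> cut (Suc m) \<le> cut l"
    using cut_mono[of "Suc l" m] cut_mono[of "Suc m" l] lm by linarith
  then have "real (cut (Suc l)) \<le> real (cut m) \<or> real (cut (Suc m)) \<le> real (cut l)" by simp
  then show "interior B \<inter> interior C = {}"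
    using lm by (auto simp: piece_def interior_cbox mem_box_3)
next
  show "\<Union> (piece ` {..<K}) = cbox 0 (vector [1, 1, real n])"
  proof (rule set_eqI)
    fix x :: "real ^ 3"
    have "(\<exists>m<K. real (cut m) \<le> x $ 3 \<and> x $ 3 \<le> real (cut (Suc m))) \<longleftrightarrow> 0 \<le> x $ 3 \<and> x $ 3 \<le> real n"
    proof
      assume "\<exists>m<K. real (cut m) \<le> x $ 3 \<and> x $ 3 \<le> real (cut (Suc m))"
      then obtain m where m: "m < K" "real (cut m) \<le> x $ 3" "x $ 3 \<le> real (cut (Suc m))" by blast
      then have "real (cut (Suc m)) \<le> real n" using cut_le[of "Suc m"] by simp
      with m show "0 \<le> x $ 3 \<and> x $ 3 \<le> real n" by (meson of_nat_0_le_iff order_trans)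
    next
      assume "0 \<le> x $ 3 \<and> x $ 3 \<le> real n"
      then show "\<exists>m<K. real (cut m) \<le> x $ 3 \<and> x $ 3 \<le> real (cut (Suc m))"
        using rod_cells[of "x $ 3" K] K cut_K by auto
    qed
    then show "x \<in> \<Union> (piece ` {..<K}) \<longleftrightarrow> x \<in> cbox 0 (vector [1, 1, real n])"
      by (auto simp: piece_def mem_cbox_3)
  qed
qed simp

lemma pieces_division: "piece ` {..<K + 2} division_of cube n"
proof -
  have n1: "1 \<le> real n" using n_ge_3 by simp
  have "vector [1, 1, 0] \<in> piece K" "vector [1, 1, 0] \<in> piece (Suc K)"
    using n1 by (auto simp: piece_def mem_cbox_3)
  then have ne: "piece K \<noteq> {}" "piece (Suc K) \<noteq> {}" by auto
  have plate: "{piece K} division_of piece K" and slab: "{piece (Suc K)} division_of piece (Suc K)"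
    using ne by (auto simp: piece_def intro!: division_of_self)
  have "piece ` {..<K} \<union> {piece K} division_of cbox 0 (vector [1, 1, real n]) \<union> piece K"
    by (rule division_disjoint_union[OF rods_division plate])
       (auto simp: piece_def interior_cbox mem_box_3)
  also have "cbox 0 (vector [1, 1, real n]) \<union> piece K = cbox 0 (vector [1, real n, real n])"
    using n1 by (auto simp: piece_def mem_cbox_3)
  finally have "(piece ` {..<K} \<union> {piece K}) \<union> {piece (Suc K)}
      division_of cbox 0 (vector [1, real n, real n]) \<union> piece (Suc K)"
    by (rule division_disjoint_union[OF _ slab]) (auto simp: piece_def interior_cbox mem_box_3)
  also have "cbox 0 (vector [1, real n, real n]) \<union> piece (Suc K) = cube n"
    using n1 by (auto simp: piece_def cube_def mem_cbox_3)
  also have "(piece ` {..<K} \<union> {piece K}) \<union> {piece (Suc K)} = piece ` {..<K + 2}"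
    by (auto simp: lessThan_Suc)
  finally show ?thesis .
qed

lemma side_piece:
  "m < K \<Longrightarrow> side (piece m) 1 = 1"
  "m < K \<Longrightarrow> side (piece m) 2 = 1"
  "m < K \<Longrightarrow> side (piece m) 3 = real (cut (Suc m)) - real (cut m)"
  "side (piece K) 1 = 1" "side (piece K) 2 = real n - 1" "side (piece K) 3 = real n"
  "side (piece (Suc K)) 1 = real n - 1" "side (piece (Suc K)) 2 = real n" "side (piece (Suc K)) 3 = real n"
proof -
  have lt: "cut m < cut (Suc m)" if "m < K" using cut_Suc[OF that] by simp
  have *: "side (cbox a b) i = b $ i - a $ i" if "a $ 1 < b $ 1" "a $ 2 < b $ 2" "a $ 3 < b $ 3" for a b i
    using that by (intro side_cbox) (metis exhaust_3)
  show "m < K \<Longrightarrow> side (piece m) 1 = 1"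
    "m < K \<Longrightarrow> side (piece m) 2 = 1"
    "m < K \<Longrightarrow> side (piece m) 3 = real (cut (Suc m)) - real (cut m)"
    using lt by (simp_all add: piece_def *)
  show "side (piece K) 1 = 1" "side (piece K) 2 = real n - 1" "side (piece K) 3 = real n"
    "side (piece (Suc K)) 1 = real n - 1" "side (piece (Suc K)) 2 = real n" "side (piece (Suc K)) 3 = real n"
    using n_ge_3 by (simp_all add: piece_def *)
qed

lemma integer_box_piece: "m < K + 2 \<Longrightarrow> integer_box (piece m)"
proof -
  have *: "integer_box (cbox a b)"
    if "\<forall>i\<in>{1,2,3}. a $ i \<in> \<int> \<and> b $ i \<in> \<int> \<and> a $ i < b $ i" for a b :: "real ^ 3"
    unfolding integer_box_def using that by (intro exI[of _ a] exI[of _ b]) (simp add: forall_3)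
  have lt: "cut m < cut (Suc m)" if "m < K" using cut_Suc[OF that] by simp
  show ?thesis
    unfolding piece_def using lt n_ge_3 by (auto intro!: *)
qed

lemma rod_lengths_strict_mono:
  assumes "l < m" "m < K"
  shows "real (cut (Suc l)) - real (cut l) < real (cut (Suc m)) - real (cut m)"
  using cut_Suc_eq[of l] cut_Suc[of m] assms by linarith

lemma dims_inj: "inj_on (\<lambda>m. dims (piece m)) {..<K + 2}"
proof (rule inj_onI)
  fix l m assume lm: "l \<in> {..<K + 2}" "m \<in> {..<K + 2}" and eq: "dims (piece l) = dims (piece m)"
  \<comment> \<open>Rods, plate and slab differ in the number of sides of length 1, because \<open>n - 1 \<ge> 2\<close>; rods
    among each other differ in length.\<close>
  have rod: "2 \<le> count (dims (piece m)) 1" if "m < K" for m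
    using that by (simp add: dims_def side_piece)
  have plate: "count (dims (piece K)) 1 = 1" and slab: "count (dims (piece (Suc K))) 1 = 0"
    using n_ge_3 by (auto simp: dims_def side_piece)
  have "l = m" if "l < K" "m < K"
  proof -
    have "real (cut (Suc l)) - real (cut l) = real (cut (Suc m)) - real (cut m)"
      using eq that by (simp add: dims_def side_piece)
    then show ?thesis
      using rod_lengths_strict_mono[of l m] rod_lengths_strict_mono[of m l] that by (cases l m rule: linorder_cases) auto
  qed
  moreover have "l < K \<or> l = K \<or> l = Suc K" "m < K \<or> m = K \<or> m = Suc K"
    using lm by auto
  ultimately show "l = m"
    using rod[of l] rod[of m] plate slab eq by fastforce
qed

lemma pieces_partition: "distinct_box_partition n (K + 2) (piece ` {..<K + 2})"
proof -
  have "inj_on dims (piece ` {..<K + 2})"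
    using dims_inj by (auto simp: inj_on_def)
  moreover have "inj_on piece {..<K + 2}"
    using dims_inj by (auto simp: inj_on_def)
  ultimately show ?thesis
    using pieces_division integer_box_piece by (auto simp: distinct_box_partition_def card_image)
qed

lemma pieces_surface:
  "(\<Sum>B\<in>piece ` {..<K + 2}. surface_area B) = 8 * (real n)^2 + 2 * real n + 2 * (real K - 1)"
proof -
  have inj: "inj_on piece {..<K + 2}"
    using dims_inj by (auto simp: inj_on_def)
  have "(\<Sum>B\<in>piece ` {..<K + 2}. surface_area B) =
      (\<Sum>m<K. surface_area (piece m)) + surface_area (piece K) + surface_area (piece (Suc K))"
    by (subst sum.reindex[OF inj]) simp
  also have "(\<Sum>m<K. surface_area (piece m)) = (\<Sum>m<K. 2 + 4 * (real (cut (Suc m)) - real (cut m)))"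
    by (intro sum.cong) (auto simp: surface_area_def side_piece)
  also have "\<dots> = 2 * real K + 4 * real n"
    using sum_lessThan_telescope[of "\<lambda>m. real (cut m)" K]
    unfolding sum.distrib sum_distrib_left[symmetric] by (simp add: cut_0 cut_K)
  finally show ?thesis
    by (simp add: surface_area_def side_piece power2_eq_square algebra_simps)
qed

end

section \<open>The minimal surface\<close>

theorem theorem21:
  fixes k :: nat
  assumes "k \<ge> 4"
  shows "(\<forall>n::nat. n \<ge> (k - 2) * (k - 1) div 2 \<longrightarrow>
            T n k = 8 * (real n)^2 + 2 * real n + 2 * (real k - 3)) \<and>
         (k - 2) * (k - 1) div 2 =
            (LEAST s::nat. \<exists>A::nat set. finite A \<and> card A = k - 2 \<and> (\<forall>a\<in>A. a > 0) \<and> s = \<Sum>A)"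
proof (intro conjI allI impI)
  have k1: "k - 1 = (k - 2) + 1" using assms by simp
  show "(k - 2) * (k - 1) div 2 =
      (LEAST s::nat. \<exists>A::nat set. finite A \<and> card A = k - 2 \<and> (\<forall>a\<in>A. a > 0) \<and> s = \<Sum>A)"
    unfolding k1 by (rule least_sum_distinct_pos[symmetric])
  fix n :: nat assume n: "n \<ge> (k - 2) * (k - 1) div 2"
  interpret rod_construction n "k - 2"
    using assms n[unfolded k1] by unfold_locales simp_all
  let ?v = "8 * (real n)^2 + 2 * real n + 2 * (real k - 3)"
  have K: "k - 2 + 2 = k" "real (k - 2) - 1 = real k - 3" using assms by (simp_all add: of_nat_diff)
  have mem: "?v \<in> total_areas n k"
    unfolding total_areas_def using pieces_partition pieces_surface unfolding K
    by (metis (mono_tags, lifting) mem_Collect_eq)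
  show "T n k = ?v"
  proof (rule antisym)
    show "T n k \<le> ?v" using mem by (rule T_le)
    have "T n k \<in> total_areas n k" using mem by (intro T_attained) auto
    then obtain P where P: "T n k = (\<Sum>B\<in>P. surface_area B)" "distinct_box_partition n k P"
      unfolding total_areas_def by blast
    then have "P division_of cube n" "\<forall>B\<in>P. integer_box B" "card P = k"
      by (auto simp: distinct_box_partition_def)
    from surface_lower_bound[OF this(1,2)] this(3) assms P(1) show "?v \<le> T n k" by simp
  qed
qed

end
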